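(* Let $\mathbb{A}=(\{a,b,c\},f,g)$ be the three element idempotent algebra given by $$f(a,b)=f(b,a)=f(b,c)=g(a,b,c)=b,$$ $$f(a,c)=f(c,a)=f(c,b)=g(a,c,b)=c,$$ $$f(x,y)\approx g(x,x,y),\qquad g(x,y,z)\approx g(y,z,x).$$ Then $\mathbb{A}$ does not have any $4$-ary term $t$ satisfying $$t(x,y,z,y)\approx t(y,x,z,z)\approx t(z,x,x,y),$$ and also does not have any $4$-ary term $t$ satisfying $$t(x,y,z,y)\approx t(y,x,x,z)\approx t(z,y,x,x).$$
   Context: Here $f$ is binary and $g$ is ternary, idempotence means $f(x,x)=x$ and $g(x,x,x)=x$, and $\approx$ denotes an identity holding for all values of the variables. The listed equations determine $f$ and $g$ completely. *)

theory Defs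
  imports Main
begin

datatype three = el_a | el_b | el_c

text \<open>Terms in the signature with one binary and one ternary operation symbol, and their
  evaluation in an algebra with basic operations \<open>f\<close> and \<open>g\<close>.\<close>

datatype (vars: 'v) trm =
    Var 'v
  | F "'v trm" "'v trm"
  | G "'v trm" "'v trm" "'v trm"

primrec eval :: "('a \<Rightarrow> 'a \<Rightarrow> 'a) \<Rightarrow> ('a \<Rightarrow> 'a \<Rightarrow> 'a \<Rightarrow> 'a) \<Rightarrow> ('v \<Rightarrow> 'a) \<Rightarrow> 'v trm \<Rightarrow> 'a"
where
  "eval f g s (Var v) = s v"
| "eval f g s (F t u) = f (eval f g s t) (eval f g s u)"
| "eval f g s (G t u v) = g (eval f g s t) (eval f g s u) (eval f g s v)"

text \<open>A 4-ary term is a term whose variables are among \<open>0, 1, 2, 3\<close>; not all of them need occur.\<close>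

definition quaternary :: "nat trm \<Rightarrow> bool" where
  "quaternary t \<longleftrightarrow> vars t \<subseteq> {..<4}"

definition term_op4 ::
  "('a \<Rightarrow> 'a \<Rightarrow> 'a) \<Rightarrow> ('a \<Rightarrow> 'a \<Rightarrow> 'a \<Rightarrow> 'a) \<Rightarrow> nat trm \<Rightarrow> 'a \<Rightarrow> 'a \<Rightarrow> 'a \<Rightarrow> 'a \<Rightarrow> 'a"
where
  "term_op4 f g t x y z w = eval f g (\<lambda>i. [x, y, z, w] ! i) t"

definition alg_A :: "(three \<Rightarrow> three \<Rightarrow> three) \<Rightarrow> (three \<Rightarrow> three \<Rightarrow> three \<Rightarrow> three) \<Rightarrow> bool" where
  "alg_A f g \<longleftrightarrow>
     (\<forall>x. f x x = x) \<and> (\<forall>x. g x x x = x) \<and>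
     f el_a el_b = el_b \<and> f el_b el_a = el_b \<and> f el_b el_c = el_b \<and> g el_a el_b el_c = el_b \<and>
     f el_a el_c = el_c \<and> f el_c el_a = el_c \<and> f el_c el_b = el_c \<and> g el_a el_c el_b = el_c \<and>
     (\<forall>x y. f x y = g x x y) \<and> (\<forall>x y z. g x y z = g y z x)"

text \<open>The equations have exactly one solution, so quantifying over all pairs satisfying
  \<open>alg_A\<close> is the same as speaking about one fixed algebra.\<close>

fun f_A :: "three \<Rightarrow> three \<Rightarrow> three" where
  "f_A el_a y = y"
| "f_A el_b y = el_b"
| "f_A el_c y = el_c"

definition g_A :: "three \<Rightarrow> three \<Rightarrow> three \<Rightarrow> three" where
  "g_A x y z =
     (if x = y then f_A x z else if y = z then f_A y x else if x = z then f_A x y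
      else if (x, y, z) \<in> {(el_a, el_b, el_c), (el_b, el_c, el_a), (el_c, el_a, el_b)}
      then el_b else el_c)"

lemma all_three: "(\<forall>x. P x) \<longleftrightarrow> P el_a \<and> P el_b \<and> P el_c"
  by (metis three.exhaust)

lemma alg_A_f_A_g_A: "alg_A f_A g_A"
  unfolding alg_A_def g_A_def by (simp add: all_three)

lemma alg_A_unique:
  assumes "alg_A f g"
  shows "f = f_A" and "g = g_A"
proof -
  have f: "f x y = f_A x y" for x y
    using assms unfolding alg_A_def by (cases x; cases y) simp_all
  then show "f = f_A" by blast
  have rot: "g x y z = g y z x" and diag: "g x x y = f x y" for x y z
    using assms unfolding alg_A_def by metis+
  have abc: "g el_a el_b el_c = el_b" "g el_a el_c el_b = el_c"
    using assms unfolding alg_A_def by blast+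
  have "g x y z = g_A x y z" for x y z
  proof (cases "x = y \<or> y = z \<or> x = z")
    case True
    then show ?thesis
      using rot diag f unfolding g_A_def by metis
  next
    case False
    have "g el_b el_c el_a = el_b" "g el_c el_a el_b = el_b"
         "g el_c el_b el_a = el_c" "g el_b el_a el_c = el_c"
      using rot abc by metis+
    with False abc show ?thesis
      unfolding g_A_def by (cases x; cases y; cases z) simp_all
  qed
  then show "g = g_A" by blast
qed

end

theory Submission
  imports Defs
begin

text \<open>Each of the two systems is already unsolvable at two triples of arguments. Let \<open>p\<close> and \<open>q\<close> be
  the common values of its three sides at these triples, which gives six evaluations of \<open>t\<close>. For any
  two of the evaluations, the pair of values of \<open>t\<close> lies in every subuniverse of \<open>A\<^sup>2\<close> that contains
  the four pairs of arguments. The subuniverses below together exclude all values of \<open>(p, q)\<close>; they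
  were found by generating subuniverses from such pairs of arguments.\<close>

definition subuniverse2 :: "('a \<Rightarrow> 'a \<Rightarrow> 'a) \<Rightarrow> ('a \<Rightarrow> 'a \<Rightarrow> 'a \<Rightarrow> 'a) \<Rightarrow> ('a \<times> 'a) set \<Rightarrow> bool" where
  "subuniverse2 f g R \<longleftrightarrow>
     (\<forall>(x, x') \<in> R. \<forall>(y, y') \<in> R. (f x y, f x' y') \<in> R) \<and>
     (\<forall>(x, x') \<in> R. \<forall>(y, y') \<in> R. \<forall>(z, z') \<in> R. (g x y z, g x' y' z') \<in> R)"

lemma eval_in_subuniverse2:
  assumes "subuniverse2 f g R" and "\<And>v. v \<in> vars t \<Longrightarrow> (s v, s' v) \<in> R"
  shows "(eval f g s t, eval f g s' t) \<in> R"
  using assms(2)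
proof (induction t)
  case (F t u)
  then have "(eval f g s t, eval f g s' t) \<in> R" "(eval f g s u, eval f g s' u) \<in> R"
    by simp_all
  then show ?case
    using assms(1) unfolding subuniverse2_def by fastforce
next
  case (G t u v)
  then have "(eval f g s t, eval f g s' t) \<in> R" "(eval f g s u, eval f g s' u) \<in> R"
    "(eval f g s v, eval f g s' v) \<in> R"
    by simp_all
  then show ?case
    using assms(1) unfolding subuniverse2_def by fastforce
qed simp

lemma term_op4_in_subuniverse2:
  assumes "subuniverse2 f g R" and "quaternary t"
    and "(x, x') \<in> R" "(y, y') \<in> R" "(z, z') \<in> R" "(w, w') \<in> R"
  shows "(term_op4 f g t x y z w, term_op4 f g t x' y' z' w') \<in> R"
  unfolding term_op4_def
proof (rule eval_in_subuniverse2[OF assms(1)])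
  fix v assume "v \<in> vars t"
  with assms(2) have "v < 4"
    unfolding quaternary_def by blast
  then have "v = 0 \<or> v = 1 \<or> v = 2 \<or> v = 3"
    by linarith
  then show "([x, y, z, w] ! v, [x', y', z', w'] ! v) \<in> R"
    using assms(3-6) by auto
qed

lemma f_A_eq_g_A: "f_A x y = g_A x x y"
  by (simp add: g_A_def)

text \<open>Closure under \<open>f_A\<close> is closure under \<open>g_A\<close> with its first
  argument repeated.\<close>

lemma subuniverse2_AI:
  assumes "\<forall>(x, x') \<in> R. \<forall>(y, y') \<in> R. \<forall>(z, z') \<in> R. (g_A x y z, g_A x' y' z') \<in> R"
  shows "subuniverse2 f_A g_A R"
  using assms unfolding subuniverse2_def f_A_eq_g_A by fast

text \<open>\<open>el_a\<close> is neutral: as soon as some argument differs from it, the value is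
  one of those other arguments.\<close>

lemma g_A_eq_a_iff: "g_A x y z = el_a \<longleftrightarrow> x = el_a \<and> y = el_a \<and> z = el_a"
  by (cases x; cases y; cases z) (simp_all add: g_A_def)

lemma subuniverse2_not_a_a: "subuniverse2 f_A g_A (- {(el_a, el_a)})"
  by (rule subuniverse2_AI) (auto simp: g_A_eq_a_iff)

text \<open>Serves through the absence of (b, b): two evaluations linked by it cannot both be
  b.\<close>

lemma subuniverse2_aa_bc_ca_cb_cc:
  "subuniverse2 f_A g_A {(el_a, el_a), (el_b, el_c), (el_c, el_a), (el_c, el_b), (el_c, el_c)}"
  by (rule subuniverse2_AI) (simp add: g_A_def)

text \<open>The converse of the previous relation after exchanging b and c, which is an automorphism
  of the algebra; it misses (c, c).\<close>

lemma subuniverse2_aa_ab_bc_cb_bb: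
  "subuniverse2 f_A g_A {(el_a, el_a), (el_a, el_b), (el_b, el_c), (el_c, el_b), (el_b, el_b)}"
  by (rule subuniverse2_AI) (simp add: g_A_def)

text \<open>This is the partial order with b above a and c, for which \<open>g_A\<close> is
  monotone.\<close>

lemma subuniverse2_aa_ab_bb_cb_cc:
  "subuniverse2 f_A g_A {(el_a, el_a), (el_a, el_b), (el_b, el_b), (el_c, el_b), (el_c, el_c)}"
  by (rule subuniverse2_AI) (simp add: g_A_def)

text \<open>This is the order b < c with a isolated. On {b, c} \<open>g_A\<close> is majority, a
  single a selects the entry cyclically after it, and two a's select the third entry; all of these
  are monotone.\<close>

lemma subuniverse2_aa_bb_bc_cc:
  "subuniverse2 f_A g_A {(el_a, el_a), (el_b, el_b), (el_b, el_c), (el_c, el_c)}"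
  by (rule subuniverse2_AI) (simp add: g_A_def)

lemma no_term_xyzy_yxzz_zxxy:
  assumes "quaternary t"
    and "\<forall>x y z. term_op4 f_A g_A t x y z y = term_op4 f_A g_A t y x z z \<and>
                 term_op4 f_A g_A t y x z z = term_op4 f_A g_A t z x x y"
  shows False
proof -
  let ?t = "term_op4 f_A g_A t"
  obtain p where p: "?t el_a el_b el_c el_b = p" "?t el_b el_a el_c el_c = p"
      "?t el_c el_a el_a el_b = p"
    using assms(2) by metis
  \<comment> \<open>While \<open>p\<close> belongs to the triple (a, b, c), \<open>q\<close> belongs
    to (b, a, c).\<close>
  obtain q where q: "?t el_b el_a el_c el_a = q" "?t el_a el_b el_c el_c = q"
      "?t el_c el_b el_b el_a = q"
    using assms(2) by metis
  note mem = term_op4_in_subuniverse2[OF _ assms(1)]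
  \<comment> \<open>The eight values are the four argument pairs in order; columns of two
    evaluations equal to \<open>p\<close>.\<close>
  have "p \<noteq> el_a"
    using mem[OF subuniverse2_not_a_a,
        of el_a el_b el_b el_a el_c el_c el_b el_c] p by simp
  moreover have "p \<noteq> el_b"
    using mem[OF subuniverse2_aa_bc_ca_cb_cc,
        of el_b el_c el_a el_a el_c el_a el_c el_b] p by auto
  moreover have "q \<noteq> el_c"
    using mem[OF subuniverse2_aa_ab_bc_cb_bb,
        of el_b el_c el_a el_b el_c el_b el_a el_a] q by auto
  \<comment> \<open>Only the last argument changes, from b up to c, so \<open>p\<close> lies below
    \<open>q\<close>.\<close>
  moreover have "p = el_c \<Longrightarrow> q = el_c"
    using mem[OF subuniverse2_aa_bb_bc_cc,
        of el_a el_a el_b el_b el_c el_c el_b el_c] p q by auto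
  ultimately show False
    by (cases p) simp_all
qed

lemma no_term_xyzy_yxxz_zyxx:
  assumes "quaternary t"
    and "\<forall>x y z. term_op4 f_A g_A t x y z y = term_op4 f_A g_A t y x x z \<and>
                 term_op4 f_A g_A t y x x z = term_op4 f_A g_A t z y x x"
  shows False
proof -
  let ?t = "term_op4 f_A g_A t"
  obtain p where p: "?t el_a el_b el_c el_b = p" "?t el_b el_a el_a el_c = p"
      "?t el_c el_b el_a el_a = p"
    using assms(2) by metis
  \<comment> \<open>Here \<open>q\<close> belongs to the reversed triple (c, b, a).\<close>
  obtain q where q: "?t el_c el_b el_a el_b = q" "?t el_b el_c el_c el_a = q"
      "?t el_a el_b el_c el_c = q"
    using assms(2) by metis
  note mem = term_op4_in_subuniverse2[OF _ assms(1)]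
  have "p \<noteq> el_a"
    using mem[OF subuniverse2_not_a_a,
        of el_a el_b el_b el_a el_c el_a el_b el_c] p by simp
  \<comment> \<open>Only the last argument changes, from a up to b, and b is maximal.\<close>
  moreover have "p = el_b \<Longrightarrow> q = el_b"
    using mem[OF subuniverse2_aa_ab_bb_cb_cc,
        of el_c el_c el_b el_b el_a el_a el_a el_b] p q by auto
  \<comment> \<open>The pair placed in the relation is (q, p), in this order.\<close>
  moreover have "\<not> (q = el_b \<and> p = el_b)"
    using mem[OF subuniverse2_aa_bc_ca_cb_cc,
        of el_b el_c el_c el_b el_c el_a el_a el_a] p q by auto
  moreover have "p = el_c \<Longrightarrow> q = el_c"
    using mem[OF subuniverse2_aa_bb_bc_cc,
        of el_a el_a el_b el_b el_c el_c el_b el_c] p q by auto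
  moreover have "\<not> (p = el_c \<and> q = el_c)"
    using mem[OF subuniverse2_aa_ab_bc_cb_bb,
        of el_b el_c el_a el_b el_a el_a el_c el_b] p q by auto
  ultimately show False
    by (cases p) simp_all
qed

theorem theorem20:
  fixes f :: "three \<Rightarrow> three \<Rightarrow> three"
    and g :: "three \<Rightarrow> three \<Rightarrow> three \<Rightarrow> three"
  assumes "alg_A f g"
  shows "\<not> (\<exists>t. quaternary t \<and>
            (\<forall>x y z. term_op4 f g t x y z y = term_op4 f g t y x z z \<and>
                     term_op4 f g t y x z z = term_op4 f g t z x x y)) \<and>
         \<not> (\<exists>t. quaternary t \<and>
            (\<forall>x y z. term_op4 f g t x y z y = term_op4 f g t y x x z \<and>
                     term_op4 f g t y x x z = term_op4 f g t z y x x))"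
  unfolding alg_A_unique[OF assms]
  using no_term_xyzy_yxzz_zxxy no_term_xyzy_yxxz_zyxx by blast

end
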